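(* Let $\mathcal C$, $D_\Gamma(n)$ and $\rho_\Gamma$ be as defined in the context, and put $b_j(n)=n^j-n^{j-1}$. For every $\Gamma\in\mathcal C$ and every $n\ge2$, $$D_\Gamma(n)\le b_{\rho_\Gamma}(n)=n^{\rho_\Gamma}-n^{\rho_\Gamma-1}.$$ For every $j\ge2$ the bound is sharp: the instance $\Gamma$ whose output tuple is the tuple of $j$ distinct variables (these being all its variables), with only the test $x\ne y$ on its first two coordinates $x,y$, has $\rho_\Gamma=j$ and $D_\Gamma(n)=b_j(n)$.
   Context: Terms. Given a finite nonempty set $X$ of variables and a finite signature $\Sigma$ (function symbols with specified arities in $\{0,1,2,\dots\}$), terms are finite rooted expressions over $X$ and $\Sigma$ with ordered arguments; terms are identified only when literally equal as expressions. An interpretation $I$ on a nonempty set $A$ assigns to each $f\in\Sigma$ of arity $d$ one (total, otherwise arbitrary) function $I_f:A^d\to A$. For an assignment $a:X\to A$ the value $u^I(a)$ of a term is defined recursively; all occurrences of $f$ use the same $I_f$. Instances and dispersion. An instance $\Gamma$ consists of variables $X=\{x_1,\dots,x_m\}$, a finite signature $\Sigma$, an output tuple $\mathbf t=(t_1,\dots,t_r)$ of terms, and a finite list $\Delta$ of tests $u\ne v$ between terms. For an interpretation $I$ on a finite nonempty set $A$ put $C_I=\{a\in A^m: u^I(a)\ne v^I(a)\text{ for every }(u\ne v)\in\Delta\}$ and $\mathbf t^I(a)=(t_1^I(a),\dots,t_r^I(a))$. For $n\ge1$, $D_\Gamma(n)=\max_I|\mathbf t^I(C_I)|$ over all interpretations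 $I$ on $[n]=\{0,\dots,n-1\}$. The class $\mathcal C$ consists of all instances with a finite set $X$ of variables containing two distinct variables $x,y$, with output tuple $(x,y,t_3,\dots,t_r)$, $r\ge2$, and with a finite list of tests that includes $x\ne y$; the terms $t_3,\dots,t_r$ may use any variables in $X$ and may repeat. Cuts. The vertices of the term graph of $\Gamma$ are the distinct subterms of the outputs and tests together with all declared variables; there is a directed edge from each immediate argument to the term containing it. A term cut is a set of vertices meeting every directed path from a variable to an output term, paths of length zero included (a cut may contain variables or output terms). $\rho_\Gamma$ is the minimum size of a term cut. *)

theory Defs
  imports "HOL-Library.FuncSet"
begin

datatype ('f, 'v) trm = Var 'v | Fun 'f "('f, 'v) trm list"

text \<open>A signature is a finite partial map assigning to each of its symbols an arity.\<close>

type_synonym 'f signature = "'f \<rightharpoonup> nat"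

fun wf_trm :: "'v set \<Rightarrow> 'f signature \<Rightarrow> ('f, 'v) trm \<Rightarrow> bool" where
  "wf_trm X F (Var x) \<longleftrightarrow> x \<in> X"
| "wf_trm X F (Fun f ts) \<longleftrightarrow> F f = Some (length ts) \<and> (\<forall>t\<in>set ts. wf_trm X F t)"

fun eval_trm :: "('f \<Rightarrow> 'a list \<Rightarrow> 'a) \<Rightarrow> ('v \<Rightarrow> 'a) \<Rightarrow> ('f, 'v) trm \<Rightarrow> 'a" where
  "eval_trm I a (Var x) = a x"
| "eval_trm I a (Fun f ts) = I f (map (eval_trm I a) ts)"

fun subterms :: "('f, 'v) trm \<Rightarrow> ('f, 'v) trm set" where
  "subterms (Var x) = {Var x}"
| "subterms (Fun f ts) = insert (Fun f ts) (\<Union>t\<in>set ts. subterms t)"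

text \<open>An element \<open>(u, v)\<close> of \<open>tests\<close> stands for the test \<open>u \<noteq> v\<close>.\<close>

record ('f, 'v) inst =
  vars :: "'v set"
  sig :: "'f signature"
  outs :: "('f, 'v) trm list"
  tests :: "(('f, 'v) trm \<times> ('f, 'v) trm) list"

definition wf_inst :: "('f, 'v) inst \<Rightarrow> bool" where
  "wf_inst \<Gamma> \<longleftrightarrow> finite (vars \<Gamma>) \<and> vars \<Gamma> \<noteq> {} \<and> finite (dom (sig \<Gamma>)) \<and>
     (\<forall>t\<in>set (outs \<Gamma>). wf_trm (vars \<Gamma>) (sig \<Gamma>) t) \<and>
     (\<forall>(u, v)\<in>set (tests \<Gamma>). wf_trm (vars \<Gamma>) (sig \<Gamma>) u \<and> wf_trm (vars \<Gamma>) (sig \<Gamma>) v)"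

text \<open>\<open>A\<^sup>d\<close> is the set of lists over \<open>A\<close> of length \<open>d\<close>. Interpretations and assignments are
  extensional, so they are determined by their values on the intended domains.\<close>

definition interpretations :: "'f signature \<Rightarrow> 'a set \<Rightarrow> ('f \<Rightarrow> 'a list \<Rightarrow> 'a) set" where
  "interpretations F A =
     (\<Pi>\<^sub>E f\<in>dom F. {xs. set xs \<subseteq> A \<and> F f = Some (length xs)} \<rightarrow>\<^sub>E A)"

definition admissible :: "('f, 'v) inst \<Rightarrow> 'a set \<Rightarrow> ('f \<Rightarrow> 'a list \<Rightarrow> 'a) \<Rightarrow> ('v \<Rightarrow> 'a) set" where
  "admissible \<Gamma> A I =
     {a \<in> vars \<Gamma> \<rightarrow>\<^sub>E A. \<forall>(u, v)\<in>set (tests \<Gamma>). eval_trm I a u \<noteq> eval_trm I a v}"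

definition out_tuple :: "('f, 'v) inst \<Rightarrow> ('f \<Rightarrow> 'a list \<Rightarrow> 'a) \<Rightarrow> ('v \<Rightarrow> 'a) \<Rightarrow> 'a list" where
  "out_tuple \<Gamma> I a = map (eval_trm I a) (outs \<Gamma>)"

definition dispersion :: "('f, 'v) inst \<Rightarrow> nat \<Rightarrow> nat" where
  "dispersion \<Gamma> n =
     Max ((\<lambda>I. card (out_tuple \<Gamma> I ` admissible \<Gamma> {..<n} I)) ` interpretations (sig \<Gamma>) {..<n})"

definition class_C :: "('f, 'v) inst set" where
  "class_C = {\<Gamma>. wf_inst \<Gamma> \<and>
     (\<exists>x\<in>vars \<Gamma>. \<exists>y\<in>vars \<Gamma>. \<exists>ts. x \<noteq> y \<and>
        outs \<Gamma> = Var x # Var y # ts \<and> (Var x, Var y) \<in> set (tests \<Gamma>))}"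

definition graph_verts :: "('f, 'v) inst \<Rightarrow> ('f, 'v) trm set" where
  "graph_verts \<Gamma> = (\<Union>t\<in>set (outs \<Gamma>). subterms t) \<union>
     (\<Union>(u, v)\<in>set (tests \<Gamma>). subterms u \<union> subterms v) \<union> Var ` vars \<Gamma>"

definition graph_edge :: "('f, 'v) inst \<Rightarrow> ('f, 'v) trm \<Rightarrow> ('f, 'v) trm \<Rightarrow> bool" where
  "graph_edge \<Gamma> s t \<longleftrightarrow> s \<in> graph_verts \<Gamma> \<and> t \<in> graph_verts \<Gamma> \<and>
     (\<exists>f ts. t = Fun f ts \<and> s \<in> set ts)"

text \<open>Paths are given by their nonempty vertex lists; a singleton list is a path of length zero.
  Edges strictly increase term size, so vertices never repeat along such a list.\<close>

definition graph_path :: "('f, 'v) inst \<Rightarrow> ('f, 'v) trm list \<Rightarrow> bool" where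
  "graph_path \<Gamma> p \<longleftrightarrow> p \<noteq> [] \<and> set p \<subseteq> graph_verts \<Gamma> \<and> successively (graph_edge \<Gamma>) p"

definition term_cut :: "('f, 'v) inst \<Rightarrow> ('f, 'v) trm set \<Rightarrow> bool" where
  "term_cut \<Gamma> S \<longleftrightarrow> S \<subseteq> graph_verts \<Gamma> \<and>
     (\<forall>p. graph_path \<Gamma> p \<and> hd p \<in> Var ` vars \<Gamma> \<and> last p \<in> set (outs \<Gamma>) \<longrightarrow> set p \<inter> S \<noteq> {})"

definition min_cut :: "('f, 'v) inst \<Rightarrow> nat" where
  "min_cut \<Gamma> = Min (card ` {S. term_cut \<Gamma> S})"

text \<open>Integer-valued, to avoid truncated subtraction of the powers. The exponent \<open>j - 1\<close> is
  truncated only for \<open>j = 0\<close>; on \<open>class_C\<close> the minimum cut size is at least 2.\<close>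

definition b_bound :: "nat \<Rightarrow> nat \<Rightarrow> int" where
  "b_bound j n = int n ^ j - int n ^ (j - 1)"

text \<open>The instance with outputs and variables \<open>xs\<close> and one test on the first two of them. Its
  terms use no function symbols, so the declared signature is left as a parameter.\<close>

definition tuple_inst :: "'f signature \<Rightarrow> 'v list \<Rightarrow> ('f, 'v) inst" where
  "tuple_inst F xs = \<lparr>vars = set xs, sig = F, outs = map Var xs,
     tests = [(Var (xs ! 0), Var (xs ! 1))]\<rparr>"

end

theory Submission
  imports Defs
begin

text \<open>The value of every output is determined by the values on a term cut \<open>S\<close>. Since \<open>x\<close> and \<open>y\<close>
  are both variables and outputs, the paths of length zero force \<open>x, y \<in> S\<close>, so an admissible
  assignment yields a function on \<open>S\<close> with distinct values at \<open>x\<close> and \<open>y\<close>; there are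
  \<open>n ^ |S| - n ^ (|S| - 1)\<close> of those.\<close>

section \<open>Counting functions and images\<close>

lemma card_PiE_neq:
  assumes "finite S" "finite A" "u \<in> S" "v \<in> S" "u \<noteq> v"
  shows "int (card {g \<in> S \<rightarrow>\<^sub>E A. g u \<noteq> g v}) = int (card A) ^ card S - int (card A) ^ (card S - 1)"
proof -
  let ?E = "{g \<in> S \<rightarrow>\<^sub>E A. g u = g v}"
  \<comment> \<open>When \<open>g u = g v\<close>, the value at \<open>v\<close> is redundant.
    Erasing it means resetting it to \<open>undefined\<close>, the value of an extensional function
    off its domain.\<close>
  have "bij_betw (\<lambda>g. g(v := undefined)) ?E (S - {v} \<rightarrow>\<^sub>E A)"
  proof (rule bij_betwI[where g = "\<lambda>h. h(v := h u)"])
    show "(\<lambda>g. g(v := undefined)) \<in> ?E \<rightarrow> (S - {v} \<rightarrow>\<^sub>E A)"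
      by (auto simp: PiE_iff extensional_def)
    show "(\<lambda>h. h(v := h u)) \<in> (S - {v} \<rightarrow>\<^sub>E A) \<rightarrow> ?E"
      using assms by (auto simp: PiE_iff extensional_def)
    show "(g(v := undefined))(v := (g(v := undefined)) u) = g" if "g \<in> ?E" for g
      using that assms by auto
    show "(h(v := h u))(v := undefined) = h" if "h \<in> S - {v} \<rightarrow>\<^sub>E A" for h
      using that by (auto simp: PiE_iff extensional_def fun_eq_iff)
  qed
  then have E: "card ?E = card A ^ (card S - 1)"
    using assms by (simp add: bij_betw_same_card card_PiE)
  have fin: "finite (S \<rightarrow>\<^sub>E A)"
    using assms by (simp add: finite_PiE)
  have "{g \<in> S \<rightarrow>\<^sub>E A. g u \<noteq> g v} = (S \<rightarrow>\<^sub>E A) - ?E"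
    by auto
  moreover have "card ?E \<le> card (S \<rightarrow>\<^sub>E A)"
    using fin by (intro card_mono) auto
  ultimately have "int (card {g \<in> S \<rightarrow>\<^sub>E A. g u \<noteq> g v}) = int (card (S \<rightarrow>\<^sub>E A)) - int (card ?E)"
    using fin by (simp add: card_Diff_subset of_nat_diff)
  then show ?thesis
    using assms E by (simp add: card_PiE)
qed

text \<open>On \<open>C\<close> the map \<open>f\<close> factors through \<open>g\<close>, so
  \<open>g\<close> C\<open>maps onto\<close>f \<open>C\<close>.\<close>

lemma card_image_le_if_factors:
  assumes "finite (g ` C)" and "\<And>a b. a \<in> C \<Longrightarrow> b \<in> C \<Longrightarrow> g a = g b \<Longrightarrow> f a = f b"
  shows "card (f ` C) \<le> card (g ` C)"
proof -
  \<comment> \<open>The chosen preimage of \<open>g a\<close> may differ from \<open>a\<close>, but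
    it has the same \<open>g\<close>-value and hence the same \<open>f\<close>-value.\<close>
  have "f a = f (inv_into C g (g a))" if "a \<in> C" for a
    using that by (intro assms(2)) (auto simp: inv_into_into f_inv_into_f)
  then have "f ` C = (\<lambda>z. f (inv_into C g z)) ` g ` C"
    by (auto simp: image_image)
  then show ?thesis
    using card_image_le[OF assms(1), of "\<lambda>z. f (inv_into C g z)"] by simp
qed

section \<open>Interpretations and evaluation\<close>

text \<open>Ensures that the \<open>Max\<close> in \<open>dispersion\<close> ranges over a finite
  set. Extensionality matters here, since the type of symbols may be infinite.\<close>

lemma finite_interpretations:
  assumes "finite (dom F)" "finite A"
  shows "finite (interpretations F A)"
  unfolding interpretations_def
proof (intro finite_PiE assms)
  fix f assume "f \<in> dom F"
  then obtain d where "F f = Some d" by auto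
  then have "{xs. set xs \<subseteq> A \<and> F f = Some (length xs)} = {xs. set xs \<subseteq> A \<and> length xs = d}"
    by auto
  then show "finite {xs. set xs \<subseteq> A \<and> F f = Some (length xs)}"
    using finite_lists_length_eq[OF assms(2)] by simp
qed

lemma interpretations_nonempty: "A \<noteq> {} \<Longrightarrow> interpretations F A \<noteq> {}"
  by (simp add: interpretations_def PiE_eq_empty_iff)

lemma eval_trm_in_carrier:
  assumes "I \<in> interpretations F A" "a \<in> X \<rightarrow>\<^sub>E A" "wf_trm X F t"
  shows "eval_trm I a t \<in> A"
  using assms(3)
proof (induction t)
  case (Fun f ts)
  have len: "F f = Some (length ts)"
    using Fun.prems by simp
  then have "I f \<in> {xs. set xs \<subseteq> A \<and> F f = Some (length xs)} \<rightarrow>\<^sub>E A"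
    using assms(1) unfolding interpretations_def PiE_iff by (blast dest: bspec)
  moreover have "map (eval_trm I a) ts \<in> {xs. set xs \<subseteq> A \<and> F f = Some (length xs)}"
    using Fun len by auto
  ultimately have "I f (map (eval_trm I a) ts) \<in> A"
    by (rule PiE_mem)
  then show ?case
    by simp
qed (use assms(2) in auto)

section \<open>Subterms, the term graph and its cuts\<close>

lemma subterms_refl: "t \<in> subterms t"
  by (cases t) auto

lemma finite_subterms: "finite (subterms t)"
  by (induction t) auto

lemma subterms_args: "Fun f ts \<in> subterms t \<Longrightarrow> s \<in> set ts \<Longrightarrow> s \<in> subterms t"
  by (induction t) (auto intro: subterms_refl)

lemma wf_trm_subterms: "wf_trm X F t \<Longrightarrow> s \<in> subterms t \<Longrightarrow> wf_trm X F s"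
  by (induction t) auto

lemma finite_graph_verts: "wf_inst \<Gamma> \<Longrightarrow> finite (graph_verts \<Gamma>)"
  by (auto simp: graph_verts_def wf_inst_def finite_subterms)

lemma graph_verts_wf: "wf_inst \<Gamma> \<Longrightarrow> t \<in> graph_verts \<Gamma> \<Longrightarrow> wf_trm (vars \<Gamma>) (sig \<Gamma>) t"
  by (fastforce simp: graph_verts_def wf_inst_def intro: wf_trm_subterms)

lemma graph_verts_args: "Fun f ts \<in> graph_verts \<Gamma> \<Longrightarrow> s \<in> set ts \<Longrightarrow> s \<in> graph_verts \<Gamma>"
  by (fastforce simp: graph_verts_def intro: subterms_args)

lemma outs_in_graph_verts: "t \<in> set (outs \<Gamma>) \<Longrightarrow> t \<in> graph_verts \<Gamma>"
  by (auto simp: graph_verts_def intro: subterms_refl)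

text \<open>This trivial cut makes the \<open>Min\<close> in \<open>min_cut\<close> range over a
  nonempty set.\<close>

lemma term_cut_graph_verts: "term_cut \<Gamma> (graph_verts \<Gamma>)"
  using hd_in_set by (fastforce simp: term_cut_def graph_path_def)

lemma finite_term_cuts: "wf_inst \<Gamma> \<Longrightarrow> finite {S. term_cut \<Gamma> S}"
  by (rule finite_subset[of _ "Pow (graph_verts \<Gamma>)"]) (auto simp: term_cut_def finite_graph_verts)

lemma min_cut_attained:
  assumes "wf_inst \<Gamma>"
  obtains S where "term_cut \<Gamma> S" "card S = min_cut \<Gamma>"
proof -
  have "min_cut \<Gamma> \<in> card ` {S. term_cut \<Gamma> S}"
    unfolding min_cut_def
    using finite_term_cuts[OF assms] term_cut_graph_verts by (intro Min_in) auto
  then show ?thesis using that by auto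
qed

text \<open>Serves both halves of the theorem: it puts the two tested variables into every cut, and
  it leaves only one cut for the sharp instance.\<close>

lemma output_var_in_term_cut:
  assumes "term_cut \<Gamma> S" "x \<in> vars \<Gamma>" "Var x \<in> set (outs \<Gamma>)"
  shows "Var x \<in> S"
proof -
  have "graph_path \<Gamma> [Var x]"
    using assms outs_in_graph_verts by (auto simp: graph_path_def)
  then have "set [Var x] \<inter> S \<noteq> {}"
    using assms unfolding term_cut_def by (metis image_eqI last_ConsL list.sel(1))
  then show ?thesis by simp
qed

section \<open>The upper bound\<close>

text \<open>Tracing back from an output along vertices outside \<open>S\<close>, one can never reach
  a variable, so every branch ends in \<open>S\<close> or at a constant. Carrying the path
  \<open>p\<close> to an output makes the claim inductive for inner terms.\<close>

lemma eval_trm_eq_if_avoiding_path: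
  assumes "wf_inst \<Gamma>" "term_cut \<Gamma> S" and agree: "\<And>s. s \<in> S \<Longrightarrow> eval_trm I a s = eval_trm I b s"
    and "graph_path \<Gamma> (t # p)" "last (t # p) \<in> set (outs \<Gamma>)" "set (t # p) \<inter> S = {}"
  shows "eval_trm I a t = eval_trm I b t"
  using assms(4-6)
proof (induction t arbitrary: p)
  case (Var x)
  then have "Var x \<in> graph_verts \<Gamma>"
    by (simp add: graph_path_def)
  then have "x \<in> vars \<Gamma>"
    using graph_verts_wf[OF assms(1)] by fastforce
  \<comment> \<open>The path now runs from a variable to an output, so the cut must meet it, which
    contradicts the choice of path.\<close>
  then have "set (Var x # p) \<inter> S \<noteq> {}"
    using Var assms(2) unfolding term_cut_def by (metis image_eqI list.sel(1))
  then show ?case using Var.prems by blast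
next
  case (Fun f ts)
  have "eval_trm I a s = eval_trm I b s" if s: "s \<in> set ts" for s
  proof (cases "s \<in> S")
    case False
    \<comment> \<open>Prepending an argument keeps the final output vertex, so the induction
      hypothesis applies to the longer path.\<close>
    have "graph_path \<Gamma> (s # Fun f ts # p)"
      using Fun.prems(1) s graph_verts_args[OF _ s] by (auto simp: graph_path_def graph_edge_def)
    then show ?thesis
      using Fun.IH[OF s] Fun.prems False by auto
  qed (rule agree)
  then show ?case
    by (simp cong: map_cong)
qed

lemma out_tuple_eq_if_agree_on_term_cut:
  assumes "wf_inst \<Gamma>" "term_cut \<Gamma> S" and agree: "\<And>s. s \<in> S \<Longrightarrow> eval_trm I a s = eval_trm I b s"
  shows "out_tuple \<Gamma> I a = out_tuple \<Gamma> I b"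
proof -
  have "eval_trm I a t = eval_trm I b t" if t: "t \<in> set (outs \<Gamma>)" for t
  proof (cases "t \<in> S")
    case False
    have "graph_path \<Gamma> [t]"
      using outs_in_graph_verts[OF t] by (simp add: graph_path_def)
    then show ?thesis
      using eval_trm_eq_if_avoiding_path[OF assms, of t "[]"] t False by simp
  qed (rule agree)
  then show ?thesis
    by (simp add: out_tuple_def)
qed

lemma card_outputs_le_b_bound:
  assumes "\<Gamma> \<in> class_C" "I \<in> interpretations (sig \<Gamma>) A" "finite A" "term_cut \<Gamma> S"
  shows "int (card (out_tuple \<Gamma> I ` admissible \<Gamma> A I)) \<le> b_bound (card S) (card A)"
proof -
  have wf: "wf_inst \<Gamma>"
    using assms(1) by (simp add: class_C_def)
  obtain x y ts where xy: "x \<in> vars \<Gamma>" "y \<in> vars \<Gamma>" "x \<noteq> y" "outs \<Gamma> = Var x # Var y # ts"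
    and test: "(Var x, Var y) \<in> set (tests \<Gamma>)"
    using assms(1) unfolding class_C_def by blast
  have S: "S \<subseteq> graph_verts \<Gamma>" "finite S"
    using assms(4) finite_graph_verts[OF wf] by (auto simp: term_cut_def intro: finite_subset)
  have inS: "Var x \<in> S" "Var y \<in> S"
    using output_var_in_term_cut[OF assms(4)] xy by auto
  let ?G = "{g \<in> S \<rightarrow>\<^sub>E A. g (Var x) \<noteq> g (Var y)}"
  let ?C = "admissible \<Gamma> A I"
  \<comment> \<open>Records the values on the cut as an extensional function, so that these records
    can be counted inside \<open>?G\<close>.\<close>
  define \<phi> where "\<phi> a = restrict (eval_trm I a) S" for a
  have finG: "finite ?G"
    using S(2) assms(3) by (simp add: finite_PiE)
  have sub: "\<phi> ` ?C \<subseteq> ?G"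
  proof
    fix g assume "g \<in> \<phi> ` ?C"
    then obtain a where a: "a \<in> ?C" and g: "g = \<phi> a" by blast
    have "a \<in> vars \<Gamma> \<rightarrow>\<^sub>E A"
      using a by (simp add: admissible_def)
    then have "\<phi> a \<in> S \<rightarrow>\<^sub>E A"
      using eval_trm_in_carrier[OF assms(2), of a "vars \<Gamma>"] graph_verts_wf[OF wf] S(1)
      by (auto simp: \<phi>_def)
    moreover have "a x \<noteq> a y"
      using a test by (fastforce simp: admissible_def)
    ultimately show "g \<in> ?G"
      using inS g by (simp add: \<phi>_def)
  qed
  have "out_tuple \<Gamma> I a = out_tuple \<Gamma> I b" if "\<phi> a = \<phi> b" for a b
    using that by (intro out_tuple_eq_if_agree_on_term_cut[OF wf assms(4)])
      (metis \<phi>_def restrict_apply')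
  then have "card (out_tuple \<Gamma> I ` ?C) \<le> card (\<phi> ` ?C)"
    by (rule card_image_le_if_factors[OF finite_subset[OF sub finG]])
  also have "\<dots> \<le> card ?G"
    by (rule card_mono[OF finG sub])
  finally have "int (card (out_tuple \<Gamma> I ` ?C)) \<le> int (card ?G)"
    by simp
  also have "\<dots> = b_bound (card S) (card A)"
    using card_PiE_neq[OF S(2) assms(3) inS] xy(3) by (simp add: b_bound_def)
  finally show ?thesis .
qed

text \<open>Both the maximum over interpretations and the minimum over cuts are attained, so the
  bound for one interpretation and one cut suffices.\<close>

lemma dispersion_le_b_bound:
  assumes "\<Gamma> \<in> class_C" "n > 0"
  shows "int (dispersion \<Gamma> n) \<le> b_bound (min_cut \<Gamma>) n"
proof -
  have wf: "wf_inst \<Gamma>"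
    using assms(1) by (simp add: class_C_def)
  obtain S where S: "term_cut \<Gamma> S" "card S = min_cut \<Gamma>"
    using min_cut_attained[OF wf] .
  let ?D = "(\<lambda>I. card (out_tuple \<Gamma> I ` admissible \<Gamma> {..<n} I)) ` interpretations (sig \<Gamma>) {..<n}"
  have "dispersion \<Gamma> n \<in> ?D"
    unfolding dispersion_def
  proof (rule Max_in)
    show "finite ?D"
      using wf by (simp add: finite_interpretations wf_inst_def)
    show "?D \<noteq> {}"
      using assms(2) interpretations_nonempty[of "{..<n}"] by (auto simp: lessThan_empty_iff)
  qed
  then show ?thesis
    using card_outputs_le_b_bound[OF assms(1) _ _ S(1)] S(2) by fastforce
qed

section \<open>Sharpness\<close>

lemma tuple_inst_in_class_C:
  assumes "finite (dom F)" "distinct xs" "length xs \<ge> 2"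
  shows "tuple_inst F xs \<in> class_C"
proof -
  obtain x y ys where "xs = x # y # ys"
    using assms(3) by (metis Suc_le_length_iff numeral_2_eq_2)
  then show ?thesis
    using assms by (auto simp: class_C_def wf_inst_def tuple_inst_def)
qed

text \<open>Every vertex is both a variable and an output, so the full vertex set is the only
  cut.\<close>

lemma min_cut_tuple_inst:
  assumes "distinct xs" "length xs \<ge> 2"
  shows "min_cut (tuple_inst F xs) = length xs"
proof -
  let ?\<Gamma> = "tuple_inst F xs"
  \<comment> \<open>The test therefore adds no vertices beyond the outputs.\<close>
  have "xs ! 0 \<in> set xs" "xs ! 1 \<in> set xs"
    using assms(2) by (auto intro!: nth_mem)
  then have verts: "graph_verts ?\<Gamma> = Var ` set xs"
    by (auto simp: graph_verts_def tuple_inst_def)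
  have "S = Var ` set xs" if "term_cut ?\<Gamma> S" for S
  proof
    show "S \<subseteq> Var ` set xs"
      using that verts by (simp add: term_cut_def)
    show "Var ` set xs \<subseteq> S"
      using output_var_in_term_cut[OF that] by (auto simp: tuple_inst_def)
  qed
  moreover have "term_cut ?\<Gamma> (Var ` set xs)"
    using term_cut_graph_verts[of ?\<Gamma>] verts by simp
  ultimately have "{S. term_cut ?\<Gamma> S} = {Var ` set xs}"
    by blast
  moreover have "card (Var ` set xs) = length xs"
    using assms(1) by (simp add: card_image inj_on_def distinct_card)
  ultimately show ?thesis
    by (simp add: min_cut_def)
qed

text \<open>The output tuple lists the whole assignment, so distinct admissible assignments give
  distinct outputs. No function symbol is evaluated, which is why \<open>I\<close> may be
  arbitrary.\<close>

lemma card_outputs_tuple_inst: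
  assumes "distinct xs" "length xs \<ge> 2" "finite A"
  shows "int (card (out_tuple (tuple_inst F xs) I ` admissible (tuple_inst F xs) A I)) =
    b_bound (length xs) (card A)"
proof -
  let ?\<Gamma> = "tuple_inst F xs"
  let ?C = "{a \<in> set xs \<rightarrow>\<^sub>E A. a (xs ! 0) \<noteq> a (xs ! 1)}"
  have C: "admissible ?\<Gamma> A I = ?C"
    by (simp add: admissible_def tuple_inst_def)
  have out: "out_tuple ?\<Gamma> I a = map a xs" for a
    by (simp add: out_tuple_def tuple_inst_def)
  have "inj_on (out_tuple ?\<Gamma> I) ?C"
    unfolding out by (intro inj_onI) (auto intro: PiE_ext)
  then have "card (out_tuple ?\<Gamma> I ` ?C) = card ?C"
    by (rule card_image)
  moreover have "xs ! 0 \<in> set xs" "xs ! 1 \<in> set xs" "xs ! 0 \<noteq> xs ! 1"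
    using assms nth_eq_iff_index_eq[of xs 0 1] nth_mem[of 0 xs] nth_mem[of 1 xs] by linarith+
  then have "int (card ?C) = b_bound (length xs) (card A)"
    using card_PiE_neq[OF finite_set assms(3), of "xs ! 0" xs "xs ! 1"] assms(1)
    by (simp add: b_bound_def distinct_card)
  ultimately show ?thesis
    by (simp add: C)
qed

text \<open>The count is the same for every interpretation, so the maximum is taken over a single
  value.\<close>

lemma dispersion_tuple_inst:
  assumes "distinct xs" "length xs \<ge> 2" "n > 0"
  shows "int (dispersion (tuple_inst F xs) n) = b_bound (length xs) n"
proof -
  let ?\<Gamma> = "tuple_inst F xs"
  let ?c = "\<lambda>I. card (out_tuple ?\<Gamma> I ` admissible ?\<Gamma> {..<n} I)"
  have "?c I = nat (b_bound (length xs) n)" for I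
    using card_outputs_tuple_inst[OF assms(1,2) finite_lessThan, of F I n] by simp
  moreover have "interpretations (sig ?\<Gamma>) {..<n} \<noteq> {}"
    using assms(3) by (intro interpretations_nonempty) auto
  ultimately have "dispersion ?\<Gamma> n = nat (b_bound (length xs) n)"
    by (simp add: dispersion_def image_constant_conv)
  \<comment> \<open>Being equal to a cardinality, the bound is nonnegative, so the passage through
    \<open>nat\<close> loses nothing; \<open>undefined\<close> is just some
    \<open>I\<close>.\<close>
  moreover have "b_bound (length xs) n \<ge> 0"
    using card_outputs_tuple_inst[OF assms(1,2) finite_lessThan, of F undefined n]
    by (metis card_lessThan of_nat_0_le_iff)
  ultimately show ?thesis by simp
qed

theorem proposition3p2:
  shows "(\<forall>\<Gamma> :: ('f, 'v) inst. \<Gamma> \<in> class_C \<longrightarrow>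
            (\<forall>n\<ge>2. int (dispersion \<Gamma> n) \<le> b_bound (min_cut \<Gamma>) n)) \<and>
         (\<forall>j\<ge>2. \<forall>(F :: 'f signature) (xs :: 'v list).
            finite (dom F) \<and> distinct xs \<and> length xs = j \<longrightarrow>
            tuple_inst F xs \<in> class_C \<and>
            min_cut (tuple_inst F xs) = j \<and>
            (\<forall>n\<ge>2. int (dispersion (tuple_inst F xs) n) = b_bound j n))"
  by (intro conjI allI impI; (elim conjE)?)
    (simp_all add: dispersion_le_b_bound tuple_inst_in_class_C min_cut_tuple_inst dispersion_tuple_inst)

end
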